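(* Let $\mathsf{Val}$ be a value function (and, for the threshold version, let $t\in\mathbb{R}$). The following two decision problems are linearly inter-reducible (each reduces to the other by a linear-size construction): (a) given a history deterministic (resp. $t$-threshold history deterministic) nondeterministic $\mathsf{Val}$ automaton $\mathcal{A}$ over alphabet $\Sigma_I\times\Sigma_O$ realizing a function $f$, decide the local best-value (resp. local $t$-threshold) synthesis problem for $f$; (b) given a nondeterministic $\mathsf{Val}$ automaton $\mathcal{A}'$, decide whether $\mathcal{A}'$ is history deterministic (resp. $t$-threshold history deterministic). Furthermore, a witness of history determinism (resp. $t$-threshold history determinism) of $\mathcal{A}'$, i.e. a winning strategy of Eve in the corresponding letter game, is implementable by the same computational models as a solution to the local best-value (resp. $t$-threshold) synthesis problem of $\mathcal{A}$, where $\mathcal{A}$ and $\mathcal{A}'$ are corresponding instances under the reductions.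
   Context: A nondeterministic quantitative automaton is $\mathcal{A}=(\Sigma,Q,\iota,\delta)$ with finite nonempty alphabet $\Sigma$, finite nonempty state set $Q$, initial state $\iota$, and $\delta:Q\times\Sigma\to 2^{\mathbb{Q}\times Q}$ with finite nonempty values; $(x,q')\in\delta(q,a)$ gives a transition from $q$ to $q'$ over $a$ with weight $x$. A $\mathsf{Val}$ automaton is one equipped with a value function $\mathsf{Val}:\mathbb{Q}^\omega\to\mathbb{R}$. A run on a word $w\in\Sigma^\omega$ is a sequence $\pi$ of consecutive transitions from $\iota$ over the letters of $w$; $\mathsf{Val}(\pi)$ is $\mathsf{Val}$ of its weight sequence; $\mathcal{A}(w)$ is the supremum of $\mathsf{Val}(\pi)$ over runs $\pi$ on $w$; $\mathcal{A}$ realizes the function $w\mapsto\mathcal{A}(w)$. **History determinism (nondeterministic case).** In the letter game on $\mathcal{A}$, starting from $\iota$, in each round Adam picks a letter $a\in\Sigma$ and Eve picks a transition over $a$ from the current state; this produces an infinite word $w$ and a run $\pi$. Eve wins the play in the letter game if $\mathsf{Val}(\pi)\ge\mathcal{A}(w)$, and in the $t$-threshold letter game if $\mathcal{A}(w)\ge t\implies\mathsf{Val}(\pi)\ge t$. $\mathcal{A}$ is history deterministic (resp. $t$-threshold history deterministic) if Eve has a winning strategy in the letter game (resp. $t$-threshold letter game); such a strategy is called a witness. **Local synthesis.** Let $\Sigma_I,\Sigma_O$ be finite input and output alphabets and $f:(\Sigma_I\times\Sigma_O)^\omega\to\mathbb{R}$. For $I\in\Sigma_I^\omega$, $O\in\Sigma_O^\omega$,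 $I\otimes O\in(\Sigma_I\times\Sigma_O)^\omega$ is the letterwise pairing. Let $\mathtt{Best}_f(I)=\sup_{O\in\Sigma_O^\omega}f(I\otimes O)$. A transducer $\mathcal{T}$ produces output letter by letter: the $n$-th output letter depends only on the first $n$ input letters; $\mathcal{T}(I)\in\Sigma_O^\omega$ is the output on $I\in\Sigma_I^\omega$. The local best-value synthesis problem asks for $\mathcal{T}$ such that $f(I\otimes\mathcal{T}(I))=\mathtt{Best}_f(I)$ for every $I\in\Sigma_I^\omega$. The local $t$-threshold synthesis problem asks for $\mathcal{T}$ such that for every $I\in\Sigma_I^\omega$ with $\mathtt{Best}_f(I)\ge t$ we have $f(I\otimes\mathcal{T}(I))\ge t$. Deciding the problem means deciding whether such a $\mathcal{T}$ exists; such a $\mathcal{T}$ is a solution.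
   Formalization: From (a) to (b), a solution for A yields a witness for A' in the model only if A has a history-determinism witness composable with it (else false). Models are closed under finite-state extension; sizes of (a) instances allow default entries; the linear constant is per carrier type. *)

theory Defs
  imports Complex_Main "HOL-Library.Extended_Real" "HOL-Library.Log_Nat"
begin

section \<open>Nondeterministic quantitative automata\<close>

record ('a, 'q) aut =
  alph   :: "'a set"
  states :: "'q set"
  init   :: 'q
  trans  :: "'q \<Rightarrow> 'a \<Rightarrow> (rat \<times> 'q) set"

definition automaton :: "('a, 'q) aut \<Rightarrow> bool" where
  "automaton A \<longleftrightarrow>
     finite (alph A) \<and> alph A \<noteq> {} \<and> finite (states A) \<and> init A \<in> states A \<and>
     (\<forall>q\<in>states A. \<forall>a\<in>alph A.
        finite (trans A q a) \<and> trans A q a \<noteq> {} \<and> snd ` trans A q a \<subseteq> states A)"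

definition words :: "'a set \<Rightarrow> (nat \<Rightarrow> 'a) set" where
  "words S = {w. \<forall>n. w n \<in> S}"

text \<open>A transition is determined by its source, its letter and its \<^emph>\<open>move\<close> (weight and target).
  As source and letter are known from the word and the earlier moves, a run is given by its moves.\<close>

definition is_run :: "('a, 'q) aut \<Rightarrow> (nat \<Rightarrow> 'a) \<Rightarrow> (nat \<Rightarrow> rat \<times> 'q) \<Rightarrow> bool" where
  "is_run A w \<rho> \<longleftrightarrow>
     (\<forall>n. \<rho> n \<in> trans A (case n of 0 \<Rightarrow> init A | Suc k \<Rightarrow> snd (\<rho> k)) (w n))"

definition run_val :: "((nat \<Rightarrow> rat) \<Rightarrow> real) \<Rightarrow> (nat \<Rightarrow> rat \<times> 'q) \<Rightarrow> real" where
  "run_val Val \<rho> = Val (\<lambda>n. fst (\<rho> n))"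

text \<open>The value function is arbitrary, so the supremum over the runs on a word may be infinite.\<close>

definition aut_val :: "((nat \<Rightarrow> rat) \<Rightarrow> real) \<Rightarrow> ('a, 'q) aut \<Rightarrow> (nat \<Rightarrow> 'a) \<Rightarrow> ereal" where
  "aut_val Val A w = (SUP \<rho>\<in>{\<rho>. is_run A w \<rho>}. ereal (run_val Val \<rho>))"

definition realizes ::
  "((nat \<Rightarrow> rat) \<Rightarrow> real) \<Rightarrow> ('a, 'q) aut \<Rightarrow> ((nat \<Rightarrow> 'a) \<Rightarrow> real) \<Rightarrow> bool" where
  "realizes Val A f \<longleftrightarrow> (\<forall>w\<in>words (alph A). aut_val Val A w = ereal (f w))"

section \<open>Letter games and history determinism\<close>

text \<open>\<open>Best_Value\<close> selects the plain (non-threshold) versions of the letter game and of the synthesis problem,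
  \<open>Threshold t\<close> the \<open>t\<close>-threshold versions.\<close>

datatype objective = Best_Value | Threshold real

text \<open>A function on finite words \<open>g\<close> outputs \<open>g (w 0 \<dots> w n)\<close> in step \<open>n\<close>; its value on the empty
  word plays no role. Transducers and strategies of Eve are such functions: Eve's own earlier moves
  are determined by her strategy and Adam's letters.\<close>

definition outcome :: "('a list \<Rightarrow> 'b) \<Rightarrow> (nat \<Rightarrow> 'a) \<Rightarrow> nat \<Rightarrow> 'b" where
  "outcome g w = (\<lambda>n. g (map w [0..<Suc n]))"

fun eve_wins ::
  "((nat \<Rightarrow> rat) \<Rightarrow> real) \<Rightarrow> objective \<Rightarrow> ('a, 'q) aut \<Rightarrow> (nat \<Rightarrow> 'a) \<Rightarrow> (nat \<Rightarrow> rat \<times> 'q) \<Rightarrow> bool"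
where
  "eve_wins Val Best_Value A w \<rho> \<longleftrightarrow> ereal (run_val Val \<rho>) \<ge> aut_val Val A w"
| "eve_wins Val (Threshold t) A w \<rho> \<longleftrightarrow> (aut_val Val A w \<ge> ereal t \<longrightarrow> run_val Val \<rho> \<ge> t)"

definition hd_witness ::
  "((nat \<Rightarrow> rat) \<Rightarrow> real) \<Rightarrow> objective \<Rightarrow> ('a, 'q) aut \<Rightarrow> ('a list \<Rightarrow> rat \<times> 'q) \<Rightarrow> bool" where
  "hd_witness Val obj A s \<longleftrightarrow>
     (\<forall>w\<in>words (alph A). is_run A w (outcome s w) \<and> eve_wins Val obj A w (outcome s w))"

definition history_deterministic ::
  "((nat \<Rightarrow> rat) \<Rightarrow> real) \<Rightarrow> objective \<Rightarrow> ('a, 'q) aut \<Rightarrow> bool" where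
  "history_deterministic Val obj A \<longleftrightarrow> (\<exists>s. hd_witness Val obj A s)"

section \<open>Local synthesis\<close>

definition pairing :: "(nat \<Rightarrow> 'i) \<Rightarrow> (nat \<Rightarrow> 'o) \<Rightarrow> nat \<Rightarrow> 'i \<times> 'o"  (infixl "\<otimes>" 70) where
  "I \<otimes> O' = (\<lambda>n. (I n, O' n))"

definition best :: "'o set \<Rightarrow> ((nat \<Rightarrow> 'i \<times> 'o) \<Rightarrow> real) \<Rightarrow> (nat \<Rightarrow> 'i) \<Rightarrow> ereal" where
  "best SO f I = (SUP O'\<in>words SO. ereal (f (I \<otimes> O')))"

definition transducer :: "'i set \<Rightarrow> 'o set \<Rightarrow> ('i list \<Rightarrow> 'o) \<Rightarrow> bool" where
  "transducer SI SO T \<longleftrightarrow> (\<forall>I\<in>words SI. outcome T I \<in> words SO)"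

fun meets ::
  "objective \<Rightarrow> 'o set \<Rightarrow> ((nat \<Rightarrow> 'i \<times> 'o) \<Rightarrow> real) \<Rightarrow> (nat \<Rightarrow> 'i) \<Rightarrow> (nat \<Rightarrow> 'o) \<Rightarrow> bool" where
  "meets Best_Value SO f I O' \<longleftrightarrow> ereal (f (I \<otimes> O')) = best SO f I"
| "meets (Threshold t) SO f I O' \<longleftrightarrow> (best SO f I \<ge> ereal t \<longrightarrow> f (I \<otimes> O') \<ge> t)"

definition solution ::
  "objective \<Rightarrow> 'i set \<Rightarrow> 'o set \<Rightarrow> ((nat \<Rightarrow> 'i \<times> 'o) \<Rightarrow> real) \<Rightarrow> ('i list \<Rightarrow> 'o) \<Rightarrow> bool" where
  "solution obj SI SO f T \<longleftrightarrow>
     transducer SI SO T \<and> (\<forall>I\<in>words SI. meets obj SO f I (outcome T I))"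

definition synthesis_instance ::
  "((nat \<Rightarrow> rat) \<Rightarrow> real) \<Rightarrow> objective \<Rightarrow> 'i set \<Rightarrow> 'o set \<Rightarrow> ('i \<times> 'o, 'q) aut \<Rightarrow>
     ((nat \<Rightarrow> 'i \<times> 'o) \<Rightarrow> real) \<Rightarrow> bool" where
  "synthesis_instance Val obj SI SO A f \<longleftrightarrow>
     automaton A \<and> alph A = SI \<times> SO \<and> history_deterministic Val obj A \<and> realizes Val A f"

section \<open>The two reductions\<close>

definition project :: "'i set \<Rightarrow> 'o set \<Rightarrow> ('i \<times> 'o, 'q) aut \<Rightarrow> ('i, 'q) aut" where
  "project SI SO A =
     \<lparr>alph = SI, states = states A, init = init A,
      trans = (\<lambda>q i. \<Union>o'\<in>SO. trans A q (i, o'))\<rparr>"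

text \<open>In the other direction the output letter is the move to be taken. Transition functions are
  total, so an output letter that is not an available move selects some fixed available one.\<close>

definition moves :: "('a, 'q) aut \<Rightarrow> (rat \<times> 'q) set" where
  "moves A = (\<Union>q\<in>states A. \<Union>a\<in>alph A. trans A q a)"

definition resolve :: "('a, 'q) aut \<Rightarrow> ('a \<times> (rat \<times> 'q), 'q) aut" where
  "resolve A =
     \<lparr>alph = alph A \<times> moves A, states = states A, init = init A,
      trans = (\<lambda>q (a, m). {if m \<in> trans A q a then m else SOME m'. m' \<in> trans A q a})\<rparr>"

section \<open>Sizes\<close>

definition rat_bits :: "rat \<Rightarrow> nat" where
  "rat_bits x = (case quotient_of x of (n, d) \<Rightarrow> nat (bitlen \<bar>n\<bar> + bitlen d))"

definition cost :: "(rat \<times> 'q) set \<Rightarrow> nat" where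
  "cost R = (\<Sum>(x, q)\<in>R. 1 + rat_bits x)"

definition aut_size :: "('a, 'q) aut \<Rightarrow> nat" where
  "aut_size A =
     card (alph A) + card (states A) + (\<Sum>q\<in>states A. \<Sum>a\<in>alph A. cost (trans A q a))"

text \<open>An automaton over a product alphabet is written down as a table that lists, for a state and
  an input letter, the moves over each output letter, with one optional default entry \<open>D\<close>
  standing for all output letters with move set \<open>D\<close>. Without default entries (an infinite \<open>D\<close>, of
  cost 0, matches no output letter) this is the full table, so the size is at most that of the full
  table. Every total automaton has at least one transition for each state and each pair of letters,
  so the full table of \<open>resolve A\<close> is in general not linear in the size of \<open>A\<close>.\<close>

definition synthesis_size :: "'i set \<Rightarrow> 'o set \<Rightarrow> ('i \<times> 'o, 'q) aut \<Rightarrow> nat" where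
  "synthesis_size SI SO A =
     card SI + card SO + card (states A) +
     (\<Sum>q\<in>states A. \<Sum>i\<in>SI.
        INF D. cost D + (\<Sum>o'\<in>{o'\<in>SO. trans A q (i, o') \<noteq> D}. cost (trans A q (i, o'))))"

section \<open>Computational models\<close>

definition finite_state :: "('c list \<Rightarrow> 'd) \<Rightarrow> bool" where
  "finite_state g \<longleftrightarrow>
     (\<exists>(k0 :: nat) upd out. finite (range (foldl upd k0)) \<and>
        (\<forall>u c. g (u @ [c]) = out (foldl upd k0 u) c))"

text \<open>The word \<open>w\<close> paired letterwise with the output of \<open>g\<close> on it.\<close>

definition with_output :: "('a list \<Rightarrow> 'b) \<Rightarrow> 'a list \<Rightarrow> ('a \<times> 'b) list" where
  "with_output g w = map (\<lambda>k. (w ! k, g (take (Suc k) w))) [0..<length w]"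

definition fs_closed :: "('a list \<Rightarrow> 'b) set \<Rightarrow> ('a list \<Rightarrow> 'c) set \<Rightarrow> bool" where
  "fs_closed M N \<longleftrightarrow> (\<forall>f\<in>M. \<forall>g. finite_state g \<longrightarrow> g \<circ> with_output f \<in> N)"

text \<open>A computational model (finite-state, pushdown, computable, unrestricted, \<dots>) enters through
  the sets \<open>M\<close> and \<open>N\<close> of functions it implements with output letters in \<open>'b\<close> and in \<open>'c\<close>. What is
  required of it is that a device can be extended by a finite-state component that sees the input
  letters and the outputs of the device.\<close>

definition computational_model :: "('a list \<Rightarrow> 'b) set \<Rightarrow> ('a list \<Rightarrow> 'c) set \<Rightarrow> bool" where
  "computational_model M N \<longleftrightarrow>
     fs_closed M M \<and> fs_closed M N \<and> fs_closed N M \<and> fs_closed N N"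

text \<open>\<open>K\<close> consists of functions that devices of the model can be fed into. If \<open>K\<close> is the set of
  finite-state functions, this follows from \<open>fs_closed M N\<close>.\<close>

definition cascade_closed ::
  "('a list \<Rightarrow> 'b) set \<Rightarrow> (('a \<times> 'b) list \<Rightarrow> 'c) set \<Rightarrow> ('a list \<Rightarrow> 'c) set \<Rightarrow> bool" where
  "cascade_closed M K N \<longleftrightarrow> (\<forall>T\<in>M. \<forall>s\<in>K. s \<circ> with_output T \<in> N)"

end

theory Submission
  imports Defs "HOL-Library.Countable_Set"
begin

text \<open>A run of the projection on \<open>I\<close> is a run of the original automaton on \<open>I \<otimes> O'\<close> for some output
  word \<open>O'\<close>, so the projection realizes the best value. A witness of the projection is turned into a
  transducer by emitting an output letter that admits the chosen move, and a transducer into a witness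
  by feeding its output to a witness of the original automaton. The reverse reduction is a special case:
  \<open>resolve A\<close> is deterministic, hence has a finite-state witness, and its projection has the same
  transitions as \<open>A\<close>.\<close>

section \<open>Runs and finite-state functions\<close>

text \<open>The state from which the \<open>n\<close>-th move of a run leaves. It depends on
  \<open>A\<close> only through \<open>init A\<close>, so automata with the same initial state share
  it.\<close>

definition source :: "('a, 'q) aut \<Rightarrow> (nat \<Rightarrow> rat \<times> 'q) \<Rightarrow> nat \<Rightarrow> 'q" where
  "source A \<rho> n = (case n of 0 \<Rightarrow> init A | Suc k \<Rightarrow> snd (\<rho> k))"

lemma source_simps [simp]:
  "source A \<rho> 0 = init A" "source A \<rho> (Suc n) = snd (\<rho> n)"
  by (simp_all add: source_def)

lemma is_run_iff: "is_run A w \<rho> \<longleftrightarrow> (\<forall>n. \<rho> n \<in> trans A (source A \<rho> n) (w n))"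
  by (simp add: is_run_def source_def)

lemma source_in_states:
  assumes "automaton A" "w \<in> words (alph A)" "is_run A w \<rho>"
  shows "source A \<rho> n \<in> states A"
proof (induction n)
  case 0
  then show ?case using assms(1) by (simp add: automaton_def)
next
  case (Suc n)
  have "\<rho> n \<in> trans A (source A \<rho> n) (w n)" "w n \<in> alph A"
    using assms(2,3) by (auto simp: is_run_iff words_def)
  moreover have "snd ` trans A (source A \<rho> n) (w n) \<subseteq> states A"
    using assms(1) Suc \<open>w n \<in> alph A\<close> by (simp add: automaton_def)
  ultimately show ?case by auto
qed

lemma run_exists:
  assumes A: "automaton A" and w: "w \<in> words (alph A)"
  shows "\<exists>\<rho>. is_run A w \<rho>"
proof -
  have step: "\<exists>m. m \<in> trans A q (w n) \<and> snd m \<in> states A" if "q \<in> states A" for q n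
  proof -
    have "w n \<in> alph A" using w by (simp add: words_def)
    then have "trans A q (w n) \<noteq> {}" "snd ` trans A q (w n) \<subseteq> states A"
      using A that by (auto simp: automaton_def)
    then show ?thesis by fast
  qed
  have init: "init A \<in> states A" using A by (simp add: automaton_def)
  \<comment> \<open>Dependent choice on moves instead of states: the state is the target of the
    previous move. The initial state is not such a target, which is why index 0 has its own
    clause.\<close>
  have "\<exists>\<rho>. \<forall>n. (snd (\<rho> n) \<in> states A \<and> (n = 0 \<longrightarrow> \<rho> n \<in> trans A (init A) (w 0))) \<and>
      \<rho> (Suc n) \<in> trans A (snd (\<rho> n)) (w (Suc n))"
  proof (rule dependent_nat_choice)
    show "\<exists>m. snd m \<in> states A \<and> ((0::nat) = 0 \<longrightarrow> m \<in> trans A (init A) (w 0))"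
      using step[OF init] by blast
  next
    fix m and n :: nat
    assume "snd m \<in> states A \<and> (n = 0 \<longrightarrow> m \<in> trans A (init A) (w 0))"
    then show "\<exists>m'. (snd m' \<in> states A \<and> (Suc n = 0 \<longrightarrow> m' \<in> trans A (init A) (w 0))) \<and>
        m' \<in> trans A (snd m) (w (Suc n))"
      using step[of "snd m" "Suc n"] by auto
  qed
  then obtain \<rho> where \<rho>: "\<And>n. (n = 0 \<longrightarrow> \<rho> n \<in> trans A (init A) (w 0))"
      "\<And>n. \<rho> (Suc n) \<in> trans A (snd (\<rho> n)) (w (Suc n))"
    by blast
  have "\<rho> n \<in> trans A (source A \<rho> n) (w n)" for n
    using \<rho> by (cases n) auto
  then show ?thesis unfolding is_run_iff by blast
qed

section \<open>Finite-state functions, machines that follow a run, and cascades\<close>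

lemma finite_stateI:
  assumes fin: "finite (range (foldl upd q0))"
    and g: "\<And>u c. g (u @ [c]) = out (foldl upd q0 u) c"
  shows "finite_state g"
proof -
  \<comment> \<open>\<open>finite_state\<close> fixes natural numbers as memory. A memory of any
    type is transported there by an enumeration of the finitely many reachable values; decoding is
    faithful because only these values occur.\<close>
  define R where "R = range (foldl upd q0)"
  define enc where "enc = to_nat_on R"
  define dec where "dec = from_nat_into R"
  have dec_enc: "dec (enc q) = q" if "q \<in> R" for q
    using that fin unfolding dec_def enc_def R_def
    by (intro from_nat_into_to_nat_on) (auto intro: countable_finite)
  have foldl_enc: "foldl (\<lambda>k c. enc (upd (dec k) c)) (enc q0) u = enc (foldl upd q0 u)" for u
  proof (induction u rule: rev_induct)
    case Nil
    then show ?case by simp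
  next
    case (snoc c u)
    then show ?case by (simp add: dec_enc R_def)
  qed
  have "finite (range (foldl (\<lambda>k c. enc (upd (dec k) c)) (enc q0)))"
    using finite_imageI[OF fin, of enc] by (simp add: foldl_enc image_image)
  moreover have "g (u @ [c]) = out (dec (foldl (\<lambda>k c. enc (upd (dec k) c)) (enc q0) u)) c" for u c
    by (simp add: g foldl_enc dec_enc R_def)
  ultimately show ?thesis
    unfolding finite_state_def
    by (intro exI[of _ "enc q0"] exI[of _ "\<lambda>k c. enc (upd (dec k) c)"]
        exI[of _ "\<lambda>k. out (dec k)"]) blast
qed

text \<open>The update is clamped to \<open>states A\<close> because a finite-state
  function has to be finite on all lists, including those with letters outside the alphabet.\<close>

definition state_update :: "('a, 'q) aut \<Rightarrow> ('q \<Rightarrow> 'c \<Rightarrow> 'q) \<Rightarrow> 'q \<Rightarrow> 'c \<Rightarrow> 'q" where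
  "state_update A step q c = (if step q c \<in> states A then step q c else init A)"

text \<open>A Mealy machine with the states of \<open>A\<close> as memory. \<open>out\<close> sees
  the memory reached before the last letter together with that letter, as is needed to emit a move
  leaving that state.\<close>

definition device :: "('a, 'q) aut \<Rightarrow> ('q \<Rightarrow> 'c \<Rightarrow> 'q) \<Rightarrow> ('q \<Rightarrow> 'c \<Rightarrow> 'd) \<Rightarrow> 'c list \<Rightarrow> 'd" where
  "device A step out u = out (foldl (state_update A step) (init A) (butlast u)) (last u)"

lemma finite_state_device:
  assumes "automaton A"
  shows "finite_state (device A step out)"
proof (rule finite_stateI)
  have "foldl (state_update A step) (init A) u \<in> states A" for u
    using assms by (induction u rule: rev_induct) (auto simp: automaton_def state_update_def)
  then show "finite (range (foldl (state_update A step) (init A)))"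
    using assms by (auto simp: automaton_def intro: finite_subset[of _ "states A"])
qed (simp add: device_def)

text \<open>If \<open>step\<close> reproduces the targets of a run, the memory is always the current
  state of that run; the clamping in \<open>state_update\<close> never takes effect on it.\<close>

lemma outcome_device:
  assumes states: "\<And>n. source A \<rho> n \<in> states A"
    and step: "\<And>n. step (source A \<rho> n) (w n) = snd (\<rho> n)"
  shows "outcome (device A step out) w n = out (source A \<rho> n) (w n)"
proof -
  have "foldl (state_update A step) (init A) (map w [0..<n]) = source A \<rho> n" for n
  proof (induction n)
    case 0
    then show ?case by simp
  next
    case (Suc n)
    then show ?case using states[of "Suc n"] step[of n] by (simp add: state_update_def)
  qed
  then show ?thesis by (simp add: outcome_def device_def)
qed

lemma outcome_with_output: "outcome (g \<circ> with_output f) w = outcome g (w \<otimes> outcome f w)"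
proof -
  \<comment> \<open>The prefix of length \<open>Suc k\<close> of a prefix of \<open>w\<close> is
    again a prefix of \<open>w\<close>, so the \<open>k\<close>-th pair does not depend on
    \<open>n\<close>.\<close>
  have "with_output f (map w [0..<n]) = map (w \<otimes> outcome f w) [0..<n]" for n
    unfolding with_output_def pairing_def outcome_def
    by (rule nth_equalityI) (simp_all add: take_map del: upt_Suc)
  then show ?thesis by (simp add: outcome_def del: upt_Suc)
qed

section \<open>Projection\<close>

lemma source_project [simp]: "source (project SI SO A) = source A"
  by (intro ext) (simp add: source_def project_def split: nat.split)

lemma project_simps [simp]:
  "alph (project SI SO A) = SI" "states (project SI SO A) = states A"
  "init (project SI SO A) = init A"
  "trans (project SI SO A) q i = (\<Union>o'\<in>SO. trans A q (i, o'))"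
  by (simp_all add: project_def)

lemma pairing_in_words:
  "I \<in> words SI \<Longrightarrow> O' \<in> words SO \<Longrightarrow> I \<otimes> O' \<in> words (SI \<times> SO)"
  by (simp add: words_def pairing_def)

text \<open>Runs record moves only, so the same sequence serves both automata. Choosing at every
  position an output letter that admits the move yields the output word.\<close>

lemma is_run_project:
  "is_run (project SI SO A) I \<rho> \<longleftrightarrow> (\<exists>O'\<in>words SO. is_run A (I \<otimes> O') \<rho>)"
proof -
  have "is_run (project SI SO A) I \<rho> \<longleftrightarrow>
      (\<forall>n. \<exists>o'. o' \<in> SO \<and> \<rho> n \<in> trans A (source A \<rho> n) (I n, o'))"
    by (auto simp: is_run_iff)
  also have "\<dots> \<longleftrightarrow> (\<exists>O'\<in>words SO. is_run A (I \<otimes> O') \<rho>)"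
    unfolding choice_iff is_run_iff words_def pairing_def by auto
  finally show ?thesis .
qed

text \<open>The runs of the projection on \<open>I\<close> split by output word, so their supremum
  is an iterated one whose inner part is \<open>f (I \<otimes> O')\<close>.\<close>

lemma aut_val_project:
  assumes alph: "alph A = SI \<times> SO" and f: "realizes Val A f" and I: "I \<in> words SI"
  shows "aut_val Val (project SI SO A) I = best SO f I"
proof -
  have runs: "{\<rho>. is_run (project SI SO A) I \<rho>} = (\<Union>O'\<in>words SO. {\<rho>. is_run A (I \<otimes> O') \<rho>})"
    by (auto simp: is_run_project)
  have "aut_val Val (project SI SO A) I = (SUP O'\<in>words SO. aut_val Val A (I \<otimes> O'))"
    unfolding aut_val_def runs by (simp add: SUP_UNION)
  also have "\<dots> = best SO f I"
    unfolding best_def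
    using f I by (intro SUP_cong) (auto simp: realizes_def alph pairing_in_words)
  finally show ?thesis .
qed

text \<open>Eve lets \<open>T\<close> complete Adam's input letters and answers the resulting pairs
  with \<open>s\<close>. Her run is then as good as \<open>f\<close> on the completed word, and
  \<open>T\<close> makes that as good as the best value.\<close>

lemma solution_imp_hd_witness_project:
  assumes alph: "alph A = SI \<times> SO" and f: "realizes Val A f"
    and s: "hd_witness Val obj A s" and T: "solution obj SI SO f T"
  shows "hd_witness Val obj (project SI SO A) (s \<circ> with_output T)"
  unfolding hd_witness_def
proof (intro ballI)
  fix I assume "I \<in> words (alph (project SI SO A))"
  then have I: "I \<in> words SI" by (simp add: project_def)
  define w where "w = I \<otimes> outcome T I"
  have O: "outcome T I \<in> words SO" and meets: "meets obj SO f I (outcome T I)"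
    using T I by (auto simp: solution_def transducer_def)
  have w: "w \<in> words (alph A)" using I O by (simp add: w_def alph pairing_in_words)
  then have run: "is_run A w (outcome s w)" and wins: "eve_wins Val obj A w (outcome s w)"
    using s by (auto simp: hd_witness_def)
  have "is_run (project SI SO A) I (outcome s w)"
    using run O by (auto simp: is_run_project w_def)
  moreover have "eve_wins Val obj (project SI SO A) I (outcome s w)"
    using wins meets w f aut_val_project[OF alph f I]
    by (cases obj) (auto simp: realizes_def w_def)
  ultimately show "is_run (project SI SO A) I (outcome (s \<circ> with_output T) I) \<and>
      eve_wins Val obj (project SI SO A) I (outcome (s \<circ> with_output T) I)"
    by (simp add: outcome_with_output w_def)
qed

text \<open>Reads input letters paired with the moves chosen by a strategy of the projection. The
  targets of these moves give the current state, so no further memory is needed to find a letter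
  admitting the move.\<close>

definition output_chooser :: "'o set \<Rightarrow> ('i \<times> 'o, 'q) aut \<Rightarrow> ('i \<times> (rat \<times> 'q)) list \<Rightarrow> 'o" where
  "output_chooser SO A =
     device A (\<lambda>q (i, m). snd m) (\<lambda>q (i, m). SOME o'. o' \<in> SO \<and> m \<in> trans A q (i, o'))"

lemma hd_witness_project_imp_solution:
  assumes A: "automaton A" and alph: "alph A = SI \<times> SO" and f: "realizes Val A f"
    and s: "hd_witness Val obj (project SI SO A) s"
  shows "solution obj SI SO f (output_chooser SO A \<circ> with_output s)" (is "solution _ _ _ _ ?T")
proof -
  have "outcome ?T I \<in> words SO \<and> meets obj SO f I (outcome ?T I)" if I: "I \<in> words SI" for I
  proof -
    define \<rho> where "\<rho> = outcome s I"
    have run: "is_run (project SI SO A) I \<rho>" and wins: "eve_wins Val obj (project SI SO A) I \<rho>"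
      using s I by (auto simp: hd_witness_def \<rho>_def project_def)
    obtain O' where O': "O' \<in> words SO" "is_run A (I \<otimes> O') \<rho>"
      using run by (auto simp: is_run_project)
    have src: "source A \<rho> n \<in> states A" for n
      using source_in_states[OF A _ O'(2)] I O'(1) by (simp add: alph pairing_in_words)
    have T: "outcome ?T I n = (SOME o'. o' \<in> SO \<and> \<rho> n \<in> trans A (source A \<rho> n) (I n, o'))" for n
      unfolding outcome_with_output output_chooser_def \<rho>_def[symmetric]
      by (subst outcome_device[where \<rho> = \<rho>]) (simp_all add: src pairing_def)
    \<comment> \<open>\<open>O'\<close> only shows that a suitable letter exists at each position.
      The emitted letters may differ from \<open>O'\<close>, but they admit the same moves.\<close>
    have chosen: "outcome ?T I n \<in> SO \<and> \<rho> n \<in> trans A (source A \<rho> n) (I n, outcome ?T I n)" for n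
    proof -
      have "O' n \<in> SO \<and> \<rho> n \<in> trans A (source A \<rho> n) (I n, O' n)"
        using O' by (simp add: words_def is_run_iff pairing_def)
      then show ?thesis unfolding T by (rule someI)
    qed
    then have O: "outcome ?T I \<in> words SO" and run_A: "is_run A (I \<otimes> outcome ?T I) \<rho>"
      by (auto simp: words_def is_run_iff pairing_def)
    \<comment> \<open>As \<open>\<rho>\<close> is also a run on the emitted word, \<open>f\<close>
      there is at least Eve's value, so whatever her win guarantees passes to
      \<open>f\<close>.\<close>
    have "ereal (run_val Val \<rho>) \<le> aut_val Val A (I \<otimes> outcome ?T I)"
      unfolding aut_val_def using run_A by (intro SUP_upper) simp
    also have "\<dots> = ereal (f (I \<otimes> outcome ?T I))"
      using f I O by (simp add: realizes_def alph pairing_in_words)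
    finally have val_le: "run_val Val \<rho> \<le> f (I \<otimes> outcome ?T I)" by simp
    \<comment> \<open>The converse bound, since \<open>Best_Value\<close> asks for equality with the
      supremum.\<close>
    have le_best: "ereal (f (I \<otimes> outcome ?T I)) \<le> best SO f I"
      unfolding best_def by (rule SUP_upper[OF O])
    have "meets obj SO f I (outcome ?T I)"
    proof (cases obj)
      case Best_Value
      then have "best SO f I \<le> ereal (run_val Val \<rho>)"
        using wins aut_val_project[OF alph f I] by simp
      also have "\<dots> \<le> ereal (f (I \<otimes> outcome ?T I))" using val_le by simp
      finally show ?thesis using le_best Best_Value by simp
    next
      case (Threshold t)
      then show ?thesis using wins val_le aut_val_project[OF alph f I] by auto
    qed
    with O show ?thesis by blast
  qed
  then show ?thesis by (simp add: solution_def transducer_def)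
qed

lemma automaton_project:
  assumes A: "automaton A" and alph: "alph A = SI \<times> SO"
  shows "automaton (project SI SO A)"
proof -
  have fin: "finite SI" "SI \<noteq> {}" "finite SO" "SO \<noteq> {}"
    using A by (auto simp: automaton_def alph finite_cartesian_product_iff)
  have "finite (trans A q (i, o')) \<and> trans A q (i, o') \<noteq> {} \<and> snd ` trans A q (i, o') \<subseteq> states A"
    if "q \<in> states A" "i \<in> SI" "o' \<in> SO" for q i o'
    using A that unfolding automaton_def alph by blast
  moreover have "finite (states A)" "init A \<in> states A" using A by (auto simp: automaton_def)
  ultimately show ?thesis
    using fin unfolding automaton_def project_simps by (simp add: image_UN) blast
qed

section \<open>Size of the projection\<close>

lemma cost_mono: "finite S \<Longrightarrow> R \<subseteq> S \<Longrightarrow> cost R \<le> cost S"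
  unfolding cost_def by (rule sum_mono2) auto

lemma cost_Un_le: "cost (R \<union> S) \<le> cost R + cost S"
proof (cases "finite R \<and> finite S")
  case True
  then show ?thesis unfolding cost_def by (simp add: sum_Un_nat)
next
  \<comment> \<open>The union is infinite here, and a sum over an infinite set is 0.\<close>
  case False
  then show ?thesis by (simp add: cost_def)
qed

lemma cost_UN_le: "finite X \<Longrightarrow> cost (\<Union>x\<in>X. R x) \<le> (\<Sum>x\<in>X. cost (R x))"
proof (induction X rule: finite_induct)
  case empty
  then show ?case by (simp add: cost_def)
next
  case (insert x X)
  then show ?case using cost_Un_le[of "R x" "\<Union>x\<in>X. R x"] by simp
qed

text \<open>The estimate holds for every default entry \<open>D\<close>, hence for the infimum: all
  output letters with move set \<open>D\<close> together add at most \<open>D\<close> to the union,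
  and \<open>D\<close> is paid for once.\<close>

lemma aut_size_project:
  assumes A: "automaton A" and alph: "alph A = SI \<times> SO"
  shows "aut_size (project SI SO A) \<le> synthesis_size SI SO A"
proof -
  have "SI \<noteq> {}" "finite SO"
    using A by (auto simp: automaton_def alph finite_cartesian_product_iff)
  have "cost (\<Union>o'\<in>SO. trans A q (i, o')) \<le>
      (INF D. cost D + (\<Sum>o'\<in>{o'\<in>SO. trans A q (i, o') \<noteq> D}. cost (trans A q (i, o'))))"
    if qi: "q \<in> states A" "i \<in> SI" for q i
  proof (rule cINF_greatest)
    fix D
    define X where "X = {o'\<in>SO. trans A q (i, o') \<noteq> D}"
    have fin: "finite (trans A q (i, o'))" if "o' \<in> SO" for o'
      using A qi that by (auto simp: automaton_def alph)
    have "finite X" using \<open>finite SO\<close> by (simp add: X_def)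
    show "cost (\<Union>o'\<in>SO. trans A q (i, o')) \<le>
      cost D + (\<Sum>o'\<in>{o'\<in>SO. trans A q (i, o') \<noteq> D}. cost (trans A q (i, o')))"
    proof (cases "finite D")
      case True
      have "cost (\<Union>o'\<in>SO. trans A q (i, o')) \<le> cost (D \<union> (\<Union>o'\<in>X. trans A q (i, o')))"
        using True \<open>finite X\<close> fin by (intro cost_mono) (auto simp: X_def)
      also have "\<dots> \<le> cost D + cost (\<Union>o'\<in>X. trans A q (i, o'))" by (rule cost_Un_le)
      also have "\<dots> \<le> cost D + (\<Sum>o'\<in>X. cost (trans A q (i, o')))"
        using cost_UN_le[OF \<open>finite X\<close>] by simp
      finally show ?thesis by (simp add: X_def)
    next
      \<comment> \<open>Move sets are finite, so an infinite \<open>D\<close> matches none of them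
        and the entry is the full table.\<close>
      case False
      then have "{o'\<in>SO. trans A q (i, o') \<noteq> D} = SO" using fin by auto
      then show ?thesis using cost_UN_le[OF \<open>finite SO\<close>, of "\<lambda>o'. trans A q (i, o')"] by simp
    qed
  qed simp
  then have "(\<Sum>q\<in>states A. \<Sum>i\<in>SI. cost (\<Union>o'\<in>SO. trans A q (i, o'))) \<le>
      (\<Sum>q\<in>states A. \<Sum>i\<in>SI.
        INF D. cost D + (\<Sum>o'\<in>{o'\<in>SO. trans A q (i, o') \<noteq> D}. cost (trans A q (i, o'))))"
    by (intro sum_mono)
  then show ?thesis by (simp add: aut_size_def synthesis_size_def project_def)
qed

section \<open>Deterministic automata\<close>

text \<open>Equal source states force equal moves, and equal moves lead to equal next source
  states.\<close>

lemma deterministic_run_unique: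
  assumes A: "automaton A" and det: "\<And>q a. q \<in> states A \<Longrightarrow> a \<in> alph A \<Longrightarrow> is_singleton (trans A q a)"
    and w: "w \<in> words (alph A)" and runs: "is_run A w \<rho>" "is_run A w \<sigma>"
  shows "\<sigma> = \<rho>"
proof -
  have the: "m = m'" if "m \<in> trans A (source A \<rho> n) (w n)" "m' \<in> trans A (source A \<rho> n) (w n)" for m m' n
  proof -
    have "is_singleton (trans A (source A \<rho> n) (w n))"
      using det[OF source_in_states[OF A w runs(1), of n]] w by (simp add: words_def)
    with that show ?thesis by (metis is_singletonE singletonD)
  qed
  have eq: "source A \<sigma> n = source A \<rho> n \<Longrightarrow> \<sigma> n = \<rho> n" for n
    using the[of "\<sigma> n" n "\<rho> n"] runs unfolding is_run_iff by metis
  have "source A \<sigma> n = source A \<rho> n" for n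
    by (induction n) (simp_all add: eq)
  with eq show ?thesis by blast
qed

lemma deterministic_aut_val:
  assumes "automaton A" "\<And>q a. q \<in> states A \<Longrightarrow> a \<in> alph A \<Longrightarrow> is_singleton (trans A q a)"
    and "w \<in> words (alph A)" "is_run A w \<rho>"
  shows "aut_val Val A w = ereal (run_val Val \<rho>)"
proof -
  have "{\<sigma>. is_run A w \<sigma>} = {\<rho>}"
    using deterministic_run_unique[OF assms] assms(4) by blast
  then show ?thesis by (simp add: aut_val_def)
qed

text \<open>The only run attains the value of the word, so following it wins for either objective,
  and the current state suffices as memory. Finiteness of the memory is what lets this witness be
  attached to any device later.\<close>

lemma deterministic_finite_state_hd_witness:
  assumes A: "automaton A" and det: "\<And>q a. q \<in> states A \<Longrightarrow> a \<in> alph A \<Longrightarrow> is_singleton (trans A q a)"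
  shows "\<exists>s. finite_state s \<and> hd_witness Val obj A s"
proof -
  define s where "s = device A (\<lambda>q a. snd (the_elem (trans A q a))) (\<lambda>q a. the_elem (trans A q a))"
  have "is_run A w (outcome s w) \<and> eve_wins Val obj A w (outcome s w)" if w: "w \<in> words (alph A)" for w
  proof -
    obtain \<rho> where \<rho>: "is_run A w \<rho>" using run_exists[OF A w] by blast
    note src = source_in_states[OF A w \<rho>]
    have elem: "the_elem (trans A (source A \<rho> n) (w n)) = \<rho> n" for n
    proof -
      have "is_singleton (trans A (source A \<rho> n) (w n))" "\<rho> n \<in> trans A (source A \<rho> n) (w n)"
        using det src w \<rho> by (auto simp: words_def is_run_iff)
      then show ?thesis by (auto simp: is_singleton_def)
    qed
    have "outcome s w n = \<rho> n" for n
      unfolding s_def by (subst outcome_device[where \<rho> = \<rho>]) (simp_all add: src elem)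
    then have "outcome s w = \<rho>" by blast
    then show ?thesis
      using \<rho> deterministic_aut_val[OF A det w \<rho>] by (cases obj) auto
  qed
  then have "hd_witness Val obj A s" by (simp add: hd_witness_def)
  then show ?thesis using finite_state_device[OF A] unfolding s_def by blast
qed

text \<open>The supremum over runs could be infinite in general; over a single run it is a real
  number, so a real-valued \<open>f\<close> exists.\<close>

lemma deterministic_realizes:
  assumes A: "automaton A" and det: "\<And>q a. q \<in> states A \<Longrightarrow> a \<in> alph A \<Longrightarrow> is_singleton (trans A q a)"
  shows "\<exists>f. realizes Val A f"
proof -
  have "aut_val Val A w = ereal (real_of_ereal (aut_val Val A w))" if w: "w \<in> words (alph A)" for w
  proof -
    obtain \<rho> where "is_run A w \<rho>" using run_exists[OF A w] by blast
    from deterministic_aut_val[OF A det w this] show ?thesis by simp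
  qed
  then show ?thesis
    unfolding realizes_def by (intro exI[of _ "\<lambda>w. real_of_ereal (aut_val Val A w)"]) blast
qed

section \<open>Resolution\<close>

lemma resolve_simps [simp]:
  "alph (resolve A) = alph A \<times> moves A" "states (resolve A) = states A" "init (resolve A) = init A"
  "trans (resolve A) q (a, m) = {if m \<in> trans A q a then m else SOME m'. m' \<in> trans A q a}"
  by (simp_all add: resolve_def)

lemma resolved_move:
  assumes "automaton A" "q \<in> states A" "a \<in> alph A"
  shows "(if m \<in> trans A q a then m else SOME m'. m' \<in> trans A q a) \<in> trans A q a"
  using assms by (auto simp: automaton_def some_in_eq)

lemma resolve_deterministic: "x \<in> alph (resolve A) \<Longrightarrow> is_singleton (trans (resolve A) q x)"
  by (cases x) simp

lemma finite_moves: "automaton A \<Longrightarrow> finite (moves A)"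
  by (auto simp: automaton_def moves_def)

lemma moves_subset: "q \<in> states A \<Longrightarrow> a \<in> alph A \<Longrightarrow> trans A q a \<subseteq> moves A"
  by (auto simp: moves_def)

lemma automaton_resolve:
  assumes A: "automaton A"
  shows "automaton (resolve A)"
proof -
  have parts: "finite (alph A)" "alph A \<noteq> {}" "finite (states A)" "init A \<in> states A"
    "\<And>q a. q \<in> states A \<Longrightarrow> a \<in> alph A \<Longrightarrow> trans A q a \<noteq> {}"
    "\<And>q a. q \<in> states A \<Longrightarrow> a \<in> alph A \<Longrightarrow> snd ` trans A q a \<subseteq> states A"
    using A by (auto simp: automaton_def)
  obtain a where "a \<in> alph A" using parts(2) by blast
  then have "moves A \<noteq> {}" using parts(5)[OF parts(4)] moves_subset[OF parts(4)] by blast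
  moreover have "snd ` trans (resolve A) q (a, m) \<subseteq> states A" if "q \<in> states A" "a \<in> alph A" for q a m
    using resolved_move[OF A that, of m] parts(6)[OF that] unfolding resolve_simps by blast
  ultimately show ?thesis
    unfolding automaton_def using parts(1-4) finite_moves[OF A] by auto
qed

text \<open>Every output letter selects an available move, so no move is gained; every available
  move is itself an output letter selecting itself, so none is lost.\<close>

lemma trans_project_resolve:
  assumes A: "automaton A" and q: "q \<in> states A" and a: "a \<in> alph A"
  shows "trans (project (alph A) (moves A) (resolve A)) q a = trans A q a"
proof -
  have "trans (project (alph A) (moves A) (resolve A)) q a =
      (\<Union>m\<in>moves A. {if m \<in> trans A q a then m else SOME m'. m' \<in> trans A q a})"
    by (simp add: project_def)
  also have "\<dots> = trans A q a"
  proof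
    show "\<dots> \<subseteq> trans A q a" using resolved_move[OF A q a] by blast
    show "trans A q a \<subseteq> (\<Union>m\<in>moves A. {if m \<in> trans A q a then m else SOME m'. m' \<in> trans A q a})"
      using moves_subset[OF q a] by auto
  qed
  finally show ?thesis .
qed

text \<open>The transition functions may differ outside the states and letters of \<open>A\<close>,
  so the automata need not be equal. Runs on words over the alphabet never visit these
  arguments.\<close>

lemma hd_witness_cong:
  assumes A: "automaton A" and B: "automaton B"
    and same: "alph B = alph A" "states B = states A" "init B = init A"
    and trans: "\<And>q a. q \<in> states A \<Longrightarrow> a \<in> alph A \<Longrightarrow> trans B q a = trans A q a"
  shows "hd_witness Val obj B s \<longleftrightarrow> hd_witness Val obj A s"
proof -
  have source: "source B = source A" by (intro ext) (simp add: source_def same split: nat.split)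
  have run: "is_run B w \<rho> \<longleftrightarrow> is_run A w \<rho>" if w: "w \<in> words (alph A)" for w \<rho>
  proof -
    \<comment> \<open>Being a run of either automaton already keeps the source states inside
      \<open>states A\<close>, so one fact serves both directions.\<close>
    have *: "trans B (source A \<rho> n) (w n) = trans A (source A \<rho> n) (w n)"
      if "is_run A w \<rho> \<or> is_run B w \<rho>" for n
      using that source_in_states[OF A w, of \<rho> n] source_in_states[OF B, of w \<rho> n] w
      by (intro trans) (auto simp: source same words_def)
    show ?thesis
      using * unfolding is_run_iff source by auto
  qed
  then have "aut_val Val B w = aut_val Val A w" if "w \<in> words (alph A)" for w
    using that by (simp add: aut_val_def)
  then have "eve_wins Val obj B w \<rho> \<longleftrightarrow> eve_wins Val obj A w \<rho>" if "w \<in> words (alph A)" for w \<rho>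
    using that by (cases obj) auto
  with run show ?thesis by (simp add: hd_witness_def same)
qed

lemma hd_witness_project_resolve:
  assumes "automaton A"
  shows "hd_witness Val obj (project (alph A) (moves A) (resolve A)) s \<longleftrightarrow> hd_witness Val obj A s"
proof (rule hd_witness_cong[OF assms])
  show "automaton (project (alph A) (moves A) (resolve A))"
    by (rule automaton_project[OF automaton_resolve[OF assms]]) simp
qed (simp_all add: trans_project_resolve[OF assms] del: project_simps(4) resolve_simps(4))

lemma synthesis_instance_resolve:
  assumes A: "automaton A"
  shows "synthesis_instance Val obj (alph A) (moves A) (resolve A) f \<longleftrightarrow> realizes Val (resolve A) f"
  using deterministic_finite_state_hd_witness[OF automaton_resolve[OF A] resolve_deterministic]
    automaton_resolve[OF A]
  by (auto simp: synthesis_instance_def history_deterministic_def)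

text \<open>One copy of \<open>aut_size A\<close> pays for the alphabet, the states and the table,
  the second for the output alphabet \<open>moves A\<close>.\<close>

lemma synthesis_size_resolve:
  assumes A: "automaton A"
  shows "synthesis_size (alph A) (moves A) (resolve A) \<le> 2 * aut_size A"
proof -
  have fin: "finite (states A)" "finite (alph A)"
    "\<And>q a. q \<in> states A \<Longrightarrow> a \<in> alph A \<Longrightarrow> finite (trans A q a)"
    using A by (auto simp: automaton_def)
  \<comment> \<open>There are at most as many distinct moves as transitions, and each transition
    costs at least 1 whatever its weight.\<close>
  have "card (moves A) \<le> (\<Sum>q\<in>states A. card (\<Union>a\<in>alph A. trans A q a))"
    unfolding moves_def by (rule card_UN_le[OF fin(1)])
  also have "\<dots> \<le> (\<Sum>q\<in>states A. \<Sum>a\<in>alph A. card (trans A q a))"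
    by (intro sum_mono card_UN_le fin(2))
  also have "\<dots> \<le> (\<Sum>q\<in>states A. \<Sum>a\<in>alph A. cost (trans A q a))"
  proof (intro sum_mono)
    fix q a
    have "(\<Sum>_\<in>trans A q a. 1) \<le> (\<Sum>(x, q)\<in>trans A q a. 1 + rat_bits x)"
      by (rule sum_mono) (simp add: case_prod_beta)
    then show "card (trans A q a) \<le> cost (trans A q a)" by (simp add: cost_def)
  qed
  finally have card_moves: "card (moves A) \<le> (\<Sum>q\<in>states A. \<Sum>a\<in>alph A. cost (trans A q a))" .
  have entry: "(INF D. cost D + (\<Sum>m\<in>{m\<in>moves A. trans (resolve A) q (a, m) \<noteq> D}.
      cost (trans (resolve A) q (a, m)))) \<le> cost (trans A q a)"
    if q: "q \<in> states A" and a: "a \<in> alph A" for q a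
  proof -
    define d where "d = (SOME m. m \<in> trans A q a)"
    have d: "d \<in> trans A q a"
      using A q a by (auto simp: d_def automaton_def some_in_eq)
    have others: "{m\<in>moves A. trans (resolve A) q (a, m) \<noteq> {d}} = trans A q a - {d}"
      using moves_subset[OF q a] by (auto simp: d_def)
    have "(INF D. cost D + (\<Sum>m\<in>{m\<in>moves A. trans (resolve A) q (a, m) \<noteq> D}.
        cost (trans (resolve A) q (a, m)))) \<le>
        cost {d} + (\<Sum>m\<in>{m\<in>moves A. trans (resolve A) q (a, m) \<noteq> {d}}. cost (trans (resolve A) q (a, m)))"
      by (rule cINF_lower) auto
    also have "\<dots> = cost {d} + (\<Sum>m\<in>trans A q a - {d}. cost {m})"
      unfolding others by simp
    also have "\<dots> = (\<Sum>m\<in>trans A q a. cost {m})"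
      using sum.remove[OF fin(3)[OF q a] d, of "\<lambda>m. cost {m}"] by simp
    also have "\<dots> = cost (trans A q a)" by (simp add: cost_def)
    finally show ?thesis .
  qed
  have "(\<Sum>q\<in>states A. \<Sum>a\<in>alph A. INF D. cost D +
      (\<Sum>m\<in>{m\<in>moves A. trans (resolve A) q (a, m) \<noteq> D}. cost (trans (resolve A) q (a, m)))) \<le>
      (\<Sum>q\<in>states A. \<Sum>a\<in>alph A. cost (trans A q a))"
    by (intro sum_mono entry)
  then show ?thesis
    using card_moves unfolding synthesis_size_def aut_size_def resolve_simps(2) by simp
qed

section \<open>Transfer of computational models\<close>

text \<open>The translation of a strategy into a transducer only appends the finite-state
  \<open>output_chooser\<close>, so closure under finite-state extension is enough.\<close>

lemma project_implementable_solution: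
  assumes "synthesis_instance Val obj SI SO A f" "fs_closed N M"
    and "s \<in> N" "hd_witness Val obj (project SI SO A) s"
  shows "\<exists>T\<in>M. solution obj SI SO f T"
proof -
  have "automaton A" "alph A = SI \<times> SO" "realizes Val A f"
    using assms(1) by (auto simp: synthesis_instance_def)
  note sol = hd_witness_project_imp_solution[OF this assms(4)]
  have "output_chooser SO A \<circ> with_output s \<in> M"
    using assms(2,3) finite_state_device[OF \<open>automaton A\<close>]
    by (auto simp: fs_closed_def output_chooser_def)
  with sol show ?thesis by blast
qed

text \<open>Here the transducer is fed into a witness of \<open>A\<close>, which may itself need
  more than finite memory; hence the class \<open>K\<close>.\<close>

lemma solution_implementable_project:
  assumes "synthesis_instance Val obj SI SO A f" "cascade_closed M K N"
    and "s \<in> K" "hd_witness Val obj A s" "T \<in> M" "solution obj SI SO f T"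
  shows "\<exists>s\<in>N. hd_witness Val obj (project SI SO A) s"
  using assms solution_imp_hd_witness_project[of A SI SO Val f obj s T]
  unfolding synthesis_instance_def cascade_closed_def by blast

lemma solvable_iff_history_deterministic_project:
  assumes inst: "synthesis_instance Val obj SI SO A f"
  shows "(\<exists>T. solution obj SI SO f T) \<longleftrightarrow> history_deterministic Val obj (project SI SO A)"
proof -
  have "automaton A" "alph A = SI \<times> SO" "realizes Val A f" "history_deterministic Val obj A"
    using inst by (auto simp: synthesis_instance_def)
  then show ?thesis
    unfolding history_deterministic_def
    using hd_witness_project_imp_solution solution_imp_hd_witness_project by metis
qed

lemma resolve_implementable:
  assumes A: "automaton A" and f: "realizes Val (resolve A) f" and model: "computational_model M N"
  shows "(\<exists>s\<in>N. hd_witness Val obj A s) \<longleftrightarrow> (\<exists>T\<in>M. solution obj (alph A) (moves A) f T)"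
proof -
  have inst: "synthesis_instance Val obj (alph A) (moves A) (resolve A) f"
    using synthesis_instance_resolve[OF A] f by blast
  \<comment> \<open>For finite-state \<open>K\<close>, cascade closure is literally
    \<open>fs_closed M N\<close>.\<close>
  have closed: "fs_closed N M" "cascade_closed M (Collect finite_state) N"
    using model by (auto simp: computational_model_def fs_closed_def cascade_closed_def)
  obtain s where s: "s \<in> Collect finite_state" "hd_witness Val obj (resolve A) s"
    using deterministic_finite_state_hd_witness[OF automaton_resolve[OF A] resolve_deterministic]
    by blast
  show ?thesis
    using project_implementable_solution[OF inst closed(1)]
      solution_implementable_project[OF inst closed(2) s]
    unfolding hd_witness_project_resolve[OF A] by blast
qed

text \<open>In the third conjunct, passing from a solution to a witness is conditional on
  \<open>K\<close>, since it runs a witness of \<open>A\<close> after the transducer. The fourth is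
  an equivalence without \<open>K\<close>, because \<open>resolve A'\<close> always has a
  finite-state witness. A function realized by \<open>resolve A'\<close> is determined only on words
  over its alphabet, so the claims range over all such \<open>f\<close>.\<close>

theorem proposition25:
  fixes Val :: "(nat \<Rightarrow> rat) \<Rightarrow> real" and obj :: objective
  shows
    "(\<exists>c. \<forall>(SI :: 'i set) (SO :: 'o set) (A :: ('i \<times> 'o, 'q) aut) f.
        synthesis_instance Val obj SI SO A f \<longrightarrow>
          automaton (project SI SO A) \<and>
          aut_size (project SI SO A) \<le> c * synthesis_size SI SO A \<and>
          ((\<exists>T. solution obj SI SO f T) \<longleftrightarrow>
             history_deterministic Val obj (project SI SO A)))
     \<and>
     (\<exists>c. \<forall>A' :: ('a, 's) aut.
        automaton A' \<longrightarrow>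
          (\<exists>f. synthesis_instance Val obj (alph A') (moves A') (resolve A') f) \<and>
          synthesis_size (alph A') (moves A') (resolve A') \<le> c * aut_size A' \<and>
          (\<forall>f. realizes Val (resolve A') f \<longrightarrow>
             (history_deterministic Val obj A' \<longleftrightarrow>
              (\<exists>T. solution obj (alph A') (moves A') f T))))
     \<and>
     (\<forall>(SI :: 'i set) (SO :: 'o set) (A :: ('i \<times> 'o, 'q) aut) f M N.
        synthesis_instance Val obj SI SO A f \<and> computational_model M N \<longrightarrow>
          ((\<exists>s\<in>N. hd_witness Val obj (project SI SO A) s) \<longrightarrow> (\<exists>T\<in>M. solution obj SI SO f T)) \<and>
          (\<forall>K. cascade_closed M K N \<and> (\<exists>s\<in>K. hd_witness Val obj A s) \<longrightarrow>
             (\<exists>T\<in>M. solution obj SI SO f T) \<longrightarrow> (\<exists>s\<in>N. hd_witness Val obj (project SI SO A) s)))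
     \<and>
     (\<forall>(A' :: ('a, 's) aut) f M N.
        automaton A' \<and> realizes Val (resolve A') f \<and> computational_model M N \<longrightarrow>
          ((\<exists>s\<in>N. hd_witness Val obj A' s) \<longleftrightarrow>
           (\<exists>T\<in>M. solution obj (alph A') (moves A') f T)))"
proof (intro conjI)
  show "\<exists>c. \<forall>(SI :: 'i set) (SO :: 'o set) (A :: ('i \<times> 'o, 'q) aut) f.
        synthesis_instance Val obj SI SO A f \<longrightarrow>
          automaton (project SI SO A) \<and>
          aut_size (project SI SO A) \<le> c * synthesis_size SI SO A \<and>
          ((\<exists>T. solution obj SI SO f T) \<longleftrightarrow>
             history_deterministic Val obj (project SI SO A))"
  proof (intro exI[of _ 1] allI impI conjI)
    fix SI :: "'i set" and SO :: "'o set" and A :: "('i \<times> 'o, 'q) aut" and f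
    assume inst: "synthesis_instance Val obj SI SO A f"
    then have A: "automaton A" "alph A = SI \<times> SO" by (auto simp: synthesis_instance_def)
    show "automaton (project SI SO A)" by (rule automaton_project[OF A])
    show "aut_size (project SI SO A) \<le> 1 * synthesis_size SI SO A"
      using aut_size_project[OF A] by simp
    show "(\<exists>T. solution obj SI SO f T) \<longleftrightarrow> history_deterministic Val obj (project SI SO A)"
      by (rule solvable_iff_history_deterministic_project[OF inst])
  qed
next
  show "\<exists>c. \<forall>A' :: ('a, 's) aut.
        automaton A' \<longrightarrow>
          (\<exists>f. synthesis_instance Val obj (alph A') (moves A') (resolve A') f) \<and>
          synthesis_size (alph A') (moves A') (resolve A') \<le> c * aut_size A' \<and>
          (\<forall>f. realizes Val (resolve A') f \<longrightarrow>
             (history_deterministic Val obj A' \<longleftrightarrow>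
              (\<exists>T. solution obj (alph A') (moves A') f T)))"
  proof (intro exI[of _ 2] allI impI conjI)
    fix A' :: "('a, 's) aut"
    assume A': "automaton A'"
    show "\<exists>f. synthesis_instance Val obj (alph A') (moves A') (resolve A') f"
      using deterministic_realizes[OF automaton_resolve[OF A'] resolve_deterministic]
      by (simp add: synthesis_instance_resolve[OF A'])
    show "synthesis_size (alph A') (moves A') (resolve A') \<le> 2 * aut_size A'"
      by (rule synthesis_size_resolve[OF A'])
    fix f assume "realizes Val (resolve A') f"
    then have "synthesis_instance Val obj (alph A') (moves A') (resolve A') f"
      by (simp add: synthesis_instance_resolve[OF A'])
    from solvable_iff_history_deterministic_project[OF this]
    show "history_deterministic Val obj A' \<longleftrightarrow> (\<exists>T. solution obj (alph A') (moves A') f T)"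
      by (simp add: history_deterministic_def hd_witness_project_resolve[OF A'])
  qed
next
  show "(\<forall>(SI :: 'i set) (SO :: 'o set) (A :: ('i \<times> 'o, 'q) aut) f M N.
        synthesis_instance Val obj SI SO A f \<and> computational_model M N \<longrightarrow>
          ((\<exists>s\<in>N. hd_witness Val obj (project SI SO A) s) \<longrightarrow> (\<exists>T\<in>M. solution obj SI SO f T)) \<and>
          (\<forall>K. cascade_closed M K N \<and> (\<exists>s\<in>K. hd_witness Val obj A s) \<longrightarrow>
             (\<exists>T\<in>M. solution obj SI SO f T) \<longrightarrow> (\<exists>s\<in>N. hd_witness Val obj (project SI SO A) s)))"
    using project_implementable_solution solution_implementable_project
    unfolding computational_model_def by metis
next
  show "(\<forall>(A' :: ('a, 's) aut) f M N.
        automaton A' \<and> realizes Val (resolve A') f \<and> computational_model M N \<longrightarrow>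
          ((\<exists>s\<in>N. hd_witness Val obj A' s) \<longleftrightarrow>
           (\<exists>T\<in>M. solution obj (alph A') (moves A') f T)))"
    using resolve_implementable by blast
qed

end
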